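(* For every input sequence $\boldsymbol{\sigma}=(\sigma_1,\dots,\sigma_T)$, the solution $(s_1,\dots,s_T)$ produced by algorithm $\mathrm{OFA}_s$ is an optimal solution of problem SP. Here $\mathrm{OFA}_s$ is the offline algorithm which sets $s_{T+1}\leftarrow 0$ and then, for $t=T,T-1,\dots,1$ (in decreasing order), computes $\Delta(t)$ and sets $s_t\leftarrow 0$ if $\Delta(t)=-\beta$, $s_t\leftarrow 1$ if $\Delta(t)=0$, and $s_t\leftarrow s_{t+1}$ otherwise.
   Context: Fix a horizon $T\in\mathbb{N}$, a constant cancellation fee $\beta>0$ and a constant $H$. At each time $t\in\{1,\dots,T\}$ an input $\sigma_t=(e_t,p^0_t,p^1_t,B_t)$ (demand, fixed-rate price, variable-rate price, base load) determines a cost function $g_t:\{0,1\}\to\mathbb{R}$ by $g_t(1)=e_t p^1_t$ and $g_t(0)=e_t p^0_t+(p^1_t-p^0_t)(e_t-1.1B_t)^+-H(0.9B_t-e_t)^+$, where $(x)^+=\max\{x,0\}$; these cost functions are taken to be nonnegative. Problem SP: given $\boldsymbol{\sigma}$, minimize $\mathrm{Cost}(\boldsymbol{s})=\sum_{t=1}^T\big(g_t(s_t)+\beta(s_t-s_{t-1})^+\big)$ over $\boldsymbol{s}=(s_1,\dots,s_T)\in\{0,1\}^T$, with $s_0=0$. Define $\delta(t)=g_t(0)-g_t(1)$ and the cumulative cost difference $\Delta(0)=-\beta$, $\Delta(t)=\min\{0,\max\{\Delta(t-1)+\delta(t),-\beta\}\}$ for $t\ge 1$. *)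

theory Defs
  imports Complex_Main "HOL-Library.FuncSet"
begin

record price_input =
  demand :: real
  fixed_price :: real
  var_price :: real
  base_load :: real

(* States are the integers 0 and 1, with 0 the fixed-rate plan and 1 the variable-rate plan.
   The argument x is only meaningful for x = 0 and x = 1. *)
definition g :: "real \<Rightarrow> price_input \<Rightarrow> int \<Rightarrow> real" where
  "g H i x =
    (if x = 1 then demand i * var_price i
     else demand i * fixed_price i
        + (var_price i - fixed_price i) * max (demand i - 1.1 * base_load i) 0
        - H * max (0.9 * base_load i - demand i) 0)"

(* An input sequence (sigma_1, ..., sigma_T) and a solution (s_1, ..., s_T) are functions on nat
   of which only the values at 1, ..., T matter. *)
definition solutions :: "nat \<Rightarrow> (nat \<Rightarrow> int) set" where
  "solutions T = {1..T} \<rightarrow> {0, 1}"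

(* The update s(0 := 0) imposes the boundary condition s_0 = 0. *)
definition Cost :: "nat \<Rightarrow> real \<Rightarrow> real \<Rightarrow> (nat \<Rightarrow> price_input) \<Rightarrow> (nat \<Rightarrow> int) \<Rightarrow> real" where
  "Cost T \<beta> H \<sigma> s =
    (\<Sum>t = 1..T. g H (\<sigma> t) (s t) + \<beta> * real_of_int (max (s t - (s(0 := 0)) (t - 1)) 0))"

definition optimal_SP ::
  "nat \<Rightarrow> real \<Rightarrow> real \<Rightarrow> (nat \<Rightarrow> price_input) \<Rightarrow> (nat \<Rightarrow> int) \<Rightarrow> bool" where
  "optimal_SP T \<beta> H \<sigma> s \<longleftrightarrow> is_arg_min (Cost T \<beta> H \<sigma>) (\<lambda>s'. s' \<in> solutions T) s"

definition cost_diff :: "real \<Rightarrow> (nat \<Rightarrow> price_input) \<Rightarrow> nat \<Rightarrow> real" where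
  "cost_diff H \<sigma> t = g H (\<sigma> t) 0 - g H (\<sigma> t) 1"

primrec cum_diff :: "real \<Rightarrow> real \<Rightarrow> (nat \<Rightarrow> price_input) \<Rightarrow> nat \<Rightarrow> real" where
  "cum_diff \<beta> H \<sigma> 0 = - \<beta>"
| "cum_diff \<beta> H \<sigma> (Suc t) = min 0 (max (cum_diff \<beta> H \<sigma> t + cost_diff H \<sigma> (Suc t)) (- \<beta>))"

definition OFA_step ::
  "real \<Rightarrow> real \<Rightarrow> (nat \<Rightarrow> price_input) \<Rightarrow> nat \<Rightarrow> (nat \<Rightarrow> int) \<Rightarrow> (nat \<Rightarrow> int)" where
  "OFA_step \<beta> H \<sigma> t s =
    s(t := if cum_diff \<beta> H \<sigma> t = - \<beta> then 0
           else if cum_diff \<beta> H \<sigma> t = 0 then 1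
           else s (t + 1))"

(* The loop over t = T, T - 1, ..., 1, started from an array where only s_{T+1} = 0 is set. *)
definition OFA\<^sub>s :: "nat \<Rightarrow> real \<Rightarrow> real \<Rightarrow> (nat \<Rightarrow> price_input) \<Rightarrow> (nat \<Rightarrow> int)" where
  "OFA\<^sub>s T \<beta> H \<sigma> = fold (OFA_step \<beta> H \<sigma>) (rev [1..<T + 1]) ((\<lambda>_. undefined)(T + 1 := 0))"

end

(* Dynamic programming.  Let W t x be the least cost of the first t steps plus the cost of then
   moving to state x.  Then W t 0 - W t 1 is exactly the clipped quantity Delta(t), so the value of
   Delta(t) decides which predecessor attains the minimum in the recursion for W t x, and OFA_s
   follows these minimizers backwards from the state s_{T+1} = 0, which is free to move to. *)
theory Submission
  imports Defs
begin

primrec value_fun :: "real \<Rightarrow> real \<Rightarrow> (nat \<Rightarrow> price_input) \<Rightarrow> nat \<Rightarrow> int \<Rightarrow> real" where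
  "value_fun \<beta> H \<sigma> 0 x = \<beta> * real_of_int (max x 0)"
| "value_fun \<beta> H \<sigma> (Suc t) x =
    min (value_fun \<beta> H \<sigma> t 0 + g H (\<sigma> (Suc t)) 0 + \<beta> * real_of_int (max x 0))
        (value_fun \<beta> H \<sigma> t 1 + g H (\<sigma> (Suc t)) 1 + \<beta> * real_of_int (max (x - 1) 0))"

text \<open>Let a and b be the costs of the first t + 1 steps ending in state 0 and in state 1. The
  recursion gives min a b - min (a + \<beta>) b, which is a - b clipped to [-\<beta>, 0], and a - b
  is \<open>cum_diff\<close> at t plus \<open>cost_diff\<close> at t + 1.\<close>

lemma value_fun_diff:
  assumes "\<beta> > 0"
  shows "value_fun \<beta> H \<sigma> t 0 - value_fun \<beta> H \<sigma> t 1 = cum_diff \<beta> H \<sigma> t"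
proof (induction t)
  case (Suc t)
  then show ?case
    using assms by (simp add: cost_diff_def min_def max_def)
qed simp

lemma value_fun_Suc_le:
  assumes "y \<in> {0, 1}"
  shows "value_fun \<beta> H \<sigma> (Suc t) x
    \<le> value_fun \<beta> H \<sigma> t y + g H (\<sigma> (Suc t)) y + \<beta> * real_of_int (max (x - y) 0)"
  using assms by auto

text \<open>With a and b the costs of ending step t + 1 in state 0 and in state 1: at the lower clip
  a + \<beta> \<le> b, so 0 is a best last state for either target x; at the upper clip b \<le> a,
  so 1 is. Strictly between, a < b < a + \<beta>, and no switch pays off, so x itself is
  best.\<close>

lemma value_fun_Suc_eq:
  assumes "\<beta> > 0" and "x \<in> {0, 1}"
    and "y = (if cum_diff \<beta> H \<sigma> (Suc t) = - \<beta> then 0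
              else if cum_diff \<beta> H \<sigma> (Suc t) = 0 then 1 else x)"
  shows "value_fun \<beta> H \<sigma> (Suc t) x
    = value_fun \<beta> H \<sigma> t y + g H (\<sigma> (Suc t)) y + \<beta> * real_of_int (max (x - y) 0)"
  using assms value_fun_diff[OF assms(1), of H \<sigma> t]
  by (auto simp: cost_diff_def min_def max_def split: if_splits)

lemma Cost_Suc:
  "Cost (Suc t) \<beta> H \<sigma> s = Cost t \<beta> H \<sigma> s + g H (\<sigma> (Suc t)) (s (Suc t))
    + \<beta> * real_of_int (max (s (Suc t) - (s(0 := 0)) t) 0)"
  by (simp add: Cost_def)

lemma value_fun_le_Cost:
  assumes "s \<in> solutions t"
  shows "value_fun \<beta> H \<sigma> t x \<le> Cost t \<beta> H \<sigma> s + \<beta> * real_of_int (max (x - (s(0 := 0)) t) 0)"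
  using assms
proof (induction t arbitrary: x)
  case 0
  then show ?case by (simp add: Cost_def)
next
  case (Suc t)
  have "s \<in> solutions t" and y: "s (Suc t) \<in> {0, 1}"
    using Suc.prems by (auto simp: solutions_def Pi_iff)
  \<comment> \<open>The target in the induction hypothesis is the state that s actually takes next,
    so its moving cost is the switching term of step t + 1.\<close>
  from Suc.IH[OF this(1), of "s (Suc t)"] value_fun_Suc_le[OF y, of \<beta> H \<sigma> t x]
  show ?case by (simp only: Cost_Suc fun_upd_other nat.distinct simp_thms)
qed

lemma fold_OFA_step_Suc:
  "fold (OFA_step \<beta> H \<sigma>) (rev [1..<Suc n + 1]) s
    = fold (OFA_step \<beta> H \<sigma>) (rev [1..<n + 1]) (OFA_step \<beta> H \<sigma> (Suc n) s)"
  by simp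

lemma fold_OFA_step_outside:
  "t > n \<Longrightarrow> fold (OFA_step \<beta> H \<sigma>) (rev [1..<n + 1]) s t = s t"
proof (induction n arbitrary: s)
  case (Suc n)
  then show ?case
    unfolding fold_OFA_step_Suc by (subst Suc.IH) (simp_all add: OFA_step_def)
qed simp

text \<open>\<open>OFA_step\<close> reads entry t + 1 of the current array, but here the final array
  \<open>r\<close> stands on both sides: the iterations still to come write only to smaller
  indices.\<close>

lemma fold_OFA_step_inside:
  fixes \<beta> H \<sigma> n s
  defines "r \<equiv> fold (OFA_step \<beta> H \<sigma>) (rev [1..<n + 1]) s"
  assumes "t \<in> {1..n}"
  shows "r t = (if cum_diff \<beta> H \<sigma> t = - \<beta> then 0
    else if cum_diff \<beta> H \<sigma> t = 0 then 1 else r (t + 1))"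
  using assms(2) unfolding r_def
proof (induction n arbitrary: s)
  case (Suc n)
  show ?case
  proof (cases "t = Suc n")
    case True
    have "n < Suc n" "n < Suc n + 1" by simp_all
    note outside = this[THEN fold_OFA_step_outside]
    show ?thesis
      unfolding fold_OFA_step_Suc True outside by (simp add: OFA_step_def)
  next
    case False
    with Suc.prems have "t \<in> {1..n}" by simp
    then show ?thesis unfolding fold_OFA_step_Suc by (rule Suc.IH)
  qed
qed simp

lemma OFA\<^sub>s_last: "OFA\<^sub>s T \<beta> H \<sigma> (T + 1) = 0"
  by (simp only: OFA\<^sub>s_def fold_OFA_step_outside) simp

lemma OFA\<^sub>s_eq:
  "t \<in> {1..T} \<Longrightarrow>
    OFA\<^sub>s T \<beta> H \<sigma> t = (if cum_diff \<beta> H \<sigma> t = - \<beta> then 0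
      else if cum_diff \<beta> H \<sigma> t = 0 then 1 else OFA\<^sub>s T \<beta> H \<sigma> (t + 1))"
  unfolding OFA\<^sub>s_def by (rule fold_OFA_step_inside)

lemma OFA\<^sub>s_state:
  assumes "t \<in> {1..T + 1}"
  shows "OFA\<^sub>s T \<beta> H \<sigma> t \<in> {0, 1}"
proof -
  have "t \<le> T + 1" using assms by simp
  then show ?thesis using assms
  \<comment> \<open>Downward induction from the sentinel T + 1, since a copied entry takes its value
    from its successor.\<close>
  proof (induction t rule: inc_induct)
    case base
    show ?case using OFA\<^sub>s_last[of T \<beta> H \<sigma>] by simp
  next
    case (step n)
    then show ?case using OFA\<^sub>s_eq[of n T \<beta> H \<sigma>] by simp
  qed
qed

text \<open>Although the states are computed backwards, the induction runs forwards: each prefix is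
  an optimal way to reach the state that follows it.\<close>

lemma Cost_OFA\<^sub>s:
  fixes T \<beta> H \<sigma>
  defines "s \<equiv> OFA\<^sub>s T \<beta> H \<sigma>"
  assumes "\<beta> > 0" and "t \<le> T"
  shows "Cost t \<beta> H \<sigma> s + \<beta> * real_of_int (max (s (Suc t) - (s(0 := 0)) t) 0)
    = value_fun \<beta> H \<sigma> t (s (Suc t))"
  using assms(3)
proof (induction t)
  case 0
  then show ?case by (simp add: Cost_def)
next
  case (Suc t)
  \<comment> \<open>For t + 1 = T this entry is the sentinel at T + 1.\<close>
  have x: "s (Suc (Suc t)) \<in> {0, 1}"
    unfolding s_def by (rule OFA\<^sub>s_state) (use Suc.prems in simp)
  have y: "s (Suc t) = (if cum_diff \<beta> H \<sigma> (Suc t) = - \<beta> then 0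
      else if cum_diff \<beta> H \<sigma> (Suc t) = 0 then 1 else s (Suc (Suc t)))"
    using OFA\<^sub>s_eq[of "Suc t" T \<beta> H \<sigma>] Suc.prems unfolding s_def by simp
  from Suc.IH Suc.prems value_fun_Suc_eq[OF assms(2) x y]
  show ?case by (simp only: Cost_Suc fun_upd_other nat.distinct simp_thms) linarith
qed

theorem theorem1:
  fixes T :: nat and \<beta> H :: real and \<sigma> :: "nat \<Rightarrow> price_input"
  assumes "\<beta> > 0"
    and "\<And>t x. t \<in> {1..T} \<Longrightarrow> x \<in> {0, 1} \<Longrightarrow> g H (\<sigma> t) x \<ge> 0"
  shows "optimal_SP T \<beta> H \<sigma> (OFA\<^sub>s T \<beta> H \<sigma>)"
proof -
  let ?s = "OFA\<^sub>s T \<beta> H \<sigma>"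
  have sol: "?s \<in> solutions T"
    using OFA\<^sub>s_state[of _ T \<beta> H \<sigma>] by (auto simp: solutions_def)
  \<comment> \<open>Moving to state 0 is free, so at x = 0 both bounds speak of the plain cost. For
    T = 0 the last state is the boundary value.\<close>
  have free: "max (0 - (s(0 := 0)) T) 0 = 0" if "s \<in> solutions T" for s
    using that by (cases T) (force simp: solutions_def Pi_iff)+
  have "Cost T \<beta> H \<sigma> ?s = value_fun \<beta> H \<sigma> T 0"
    using Cost_OFA\<^sub>s[OF assms(1) order_refl, of T H \<sigma>] OFA\<^sub>s_last[of T \<beta> H \<sigma>] free[OF sol]
    by simp
  moreover have "value_fun \<beta> H \<sigma> T 0 \<le> Cost T \<beta> H \<sigma> s" if "s \<in> solutions T" for s
    using value_fun_le_Cost[OF that, of \<beta> H \<sigma> 0] free[OF that] by simp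
  ultimately show ?thesis
    using sol by (auto simp: optimal_SP_def is_arg_min_linorder)
qed

end
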